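(* Let $G$ be a connected uniform graph and let $m\ge 1$ be an integer. If every minimal vertex separator in $G$ has diameter at most $m$, then $G$ is hyperbolic. Moreover, $\delta(G)\le 3m-\frac12$.
   Context: Every edge of the connected graph $G$ has length $1$, interior points of edges are points of $G$, and $d$ is the induced shortest-path (length) metric on $G$, making $G$ a geodesic metric space; $V(G)$ is the vertex set. Diameters are taken with respect to $d$. $G$ is uniform if there is a constant $\mu$ such that every vertex has at most $\mu$ neighbors. A set $S\subset V(G)$ is an $ab$-separator (for vertices $a,b$) if $a$ and $b$ lie in different connected components of $G\setminus S$. It is a minimal $ab$-separator if no proper subset of $S$ separates $a$ and $b$. $S$ is a minimal vertex separator if it is a minimal $ab$-separator for some pair of vertices $a,b$. A geodesic triangle in a geodesic metric space $X$ is the union of three geodesics $[x_1x_2],[x_2x_3],[x_3x_1]$ with $x_1,x_2,x_3\in X$; it is $\delta$-thin if each side is contained in the $\delta$-neighborhood of the union of the other two sides. $X$ is $\delta$-hyperbolic if every geodesic triangle in $X$ is $\delta$-thin, and hyperbolic if it is $\delta$-hyperbolic for some $\delta\ge0$. $\delta(X):=\inf\{\delta : \text{every geodesic triangle in } X \text{ is } \delta\text{-thin}\}$. *)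

theory Defs
  imports
    "HOL-Analysis.Analysis"
    "HOL-Library.Extended_Nonnegative_Real"
    "Graph_Theory.Digraph_Component"
begin

section \<open>Geodesics and hyperbolicity in metric spaces\<close>

context Metric_space
begin

text \<open>The library's \<^const>\<open>diameter\<close> is a real number and is unspecified on unbounded sets;
  here an unbounded set has diameter \<open>\<infinity>\<close> (and the empty set has diameter \<open>0\<close>).\<close>

definition mdiameter :: "'a set \<Rightarrow> ennreal" where
  "mdiameter S = (SUP (x, y) \<in> S \<times> S. ennreal (d x y))"

definition geodesic_segment :: "'a \<Rightarrow> 'a \<Rightarrow> 'a set \<Rightarrow> bool" where
  "geodesic_segment x y A \<longleftrightarrow>
     (\<exists>(\<gamma> :: real \<Rightarrow> 'a) L. 0 \<le> L \<and> \<gamma> 0 = x \<and> \<gamma> L = y \<and> A = \<gamma> ` {0..L} \<and> A \<subseteq> M \<and>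
        (\<forall>s\<in>{0..L}. \<forall>t\<in>{0..L}. d (\<gamma> s) (\<gamma> t) = \<bar>s - t\<bar>))"

text \<open>A geodesic triangle, given by its three sides.\<close>

definition geodesic_triangle :: "'a set \<Rightarrow> 'a set \<Rightarrow> 'a set \<Rightarrow> bool" where
  "geodesic_triangle A B C \<longleftrightarrow>
     (\<exists>x1\<in>M. \<exists>x2\<in>M. \<exists>x3\<in>M.
        geodesic_segment x1 x2 A \<and> geodesic_segment x2 x3 B \<and> geodesic_segment x3 x1 C)"

definition nbhd :: "real \<Rightarrow> 'a set \<Rightarrow> 'a set" where
  "nbhd \<delta> A = (\<Union>a\<in>A. mcball a \<delta>)"

definition thin :: "real \<Rightarrow> 'a set \<Rightarrow> 'a set \<Rightarrow> 'a set \<Rightarrow> bool" where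
  "thin \<delta> A B C \<longleftrightarrow>
     A \<subseteq> nbhd \<delta> (B \<union> C) \<and> B \<subseteq> nbhd \<delta> (C \<union> A) \<and> C \<subseteq> nbhd \<delta> (A \<union> B)"

definition delta_hyperbolic :: "real \<Rightarrow> bool" where
  "delta_hyperbolic \<delta> \<longleftrightarrow> (\<forall>A B C. geodesic_triangle A B C \<longrightarrow> thin \<delta> A B C)"

definition hyperbolic :: bool where
  "hyperbolic \<longleftrightarrow> (\<exists>\<delta>\<ge>0. delta_hyperbolic \<delta>)"

text \<open>The value is \<open>\<infinity>\<close> if the space is not hyperbolic.\<close>

definition hyperbolicity_constant :: ereal where
  "hyperbolicity_constant = Inf (ereal ` {\<delta>. delta_hyperbolic \<delta>})"

end

section \<open>Graphs as length spaces\<close>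

text \<open>Simple, possibly infinite graphs are symmetric loopfree digraphs without parallel arcs
  (locale \<^locale>\<open>pair_bidirected_digraph\<close>).  Points of the geometric realization are given by
  their barycentric coordinates: \<open>edge_point u v t\<close> is the point of the edge \<open>uv\<close> at distance \<open>t\<close>
  from \<open>u\<close>, so that \<open>edge_point u v t = edge_point v u (1 - t)\<close>.\<close>

definition vertex_point :: "'a \<Rightarrow> 'a \<Rightarrow> real" where
  "vertex_point v = (\<lambda>w. of_bool (w = v))"

definition edge_point :: "'a \<Rightarrow> 'a \<Rightarrow> real \<Rightarrow> 'a \<Rightarrow> real" where
  "edge_point u v t = (\<lambda>w. (1 - t) * vertex_point u w + t * vertex_point v w)"

definition graph_points :: "'a pair_pre_digraph \<Rightarrow> ('a \<Rightarrow> real) set" where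
  "graph_points G =
     vertex_point ` pverts G \<union> {edge_point u v t | u v t. (u, v) \<in> parcs G \<and> t \<in> {0..1}}"

text \<open>\<open>pl_path G x l y\<close>: some piecewise linear path of length \<open>l\<close> goes from \<open>x\<close> to \<open>y\<close>, that is, a
  finite concatenation of segments, each contained in a closed edge of length 1.\<close>

inductive pl_path :: "'a pair_pre_digraph \<Rightarrow> ('a \<Rightarrow> real) \<Rightarrow> real \<Rightarrow> ('a \<Rightarrow> real) \<Rightarrow> bool"
  for G :: "'a pair_pre_digraph" where
  refl: "x \<in> graph_points G \<Longrightarrow> pl_path G x 0 x"
| step: "pl_path G x l (edge_point u v s) \<Longrightarrow> (u, v) \<in> parcs G \<Longrightarrow> s \<in> {0..1} \<Longrightarrow> t \<in> {0..1}
     \<Longrightarrow> pl_path G x (l + \<bar>t - s\<bar>) (edge_point u v t)"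

text \<open>The default value \<open>0\<close> only concerns pairs not joined by a path; it makes the function
  nonnegative everywhere, as the locale \<^locale>\<open>Metric_space\<close> requires.\<close>

definition graph_dist :: "'a pair_pre_digraph \<Rightarrow> ('a \<Rightarrow> real) \<Rightarrow> ('a \<Rightarrow> real) \<Rightarrow> real" where
  "graph_dist G x y = (if \<exists>l. pl_path G x l y then Inf {l. pl_path G x l y} else 0)"

definition uniform_graph :: "'a pair_pre_digraph \<Rightarrow> bool" where
  "uniform_graph G \<longleftrightarrow>
     (\<exists>\<mu>::nat. \<forall>v\<in>pverts G. finite {w. (v, w) \<in> parcs G} \<and> card {w. (v, w) \<in> parcs G} \<le> \<mu>)"

text \<open>In a symmetric digraph the strongly connected components (\<^const>\<open>pre_digraph.sccs_verts\<close>)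
  are the vertex sets of the connected components.\<close>

definition separator :: "'a pair_pre_digraph \<Rightarrow> 'a \<Rightarrow> 'a \<Rightarrow> 'a set \<Rightarrow> bool" where
  "separator G a b S \<longleftrightarrow> S \<subseteq> pverts G \<and>
     (\<exists>A \<in> pre_digraph.sccs_verts (with_proj G \<restriction> (pverts G - S)).
      \<exists>B \<in> pre_digraph.sccs_verts (with_proj G \<restriction> (pverts G - S)).
        a \<in> A \<and> b \<in> B \<and> A \<noteq> B)"

definition minimal_separator :: "'a pair_pre_digraph \<Rightarrow> 'a \<Rightarrow> 'a \<Rightarrow> 'a set \<Rightarrow> bool" where
  "minimal_separator G a b S \<longleftrightarrow> separator G a b S \<and> (\<forall>T. T \<subset> S \<longrightarrow> \<not> separator G a b T)"

definition minimal_vertex_separator :: "'a pair_pre_digraph \<Rightarrow> 'a set \<Rightarrow> bool" where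
  "minimal_vertex_separator G S \<longleftrightarrow>
     (\<exists>a\<in>pverts G. \<exists>b\<in>pverts G. minimal_separator G a b S)"

section \<open>The graph distance is a metric\<close>

lemma edge_point_0 [simp]: "edge_point u v 0 = vertex_point u"
  and edge_point_1 [simp]: "edge_point u v 1 = vertex_point v"
  by (auto simp: edge_point_def)

lemma edge_point_flip: "edge_point u v t = edge_point v u (1 - t)"
  by (auto simp: edge_point_def)

lemma pl_path_points: "pl_path G x l y \<Longrightarrow> x \<in> graph_points G \<and> y \<in> graph_points G"
  by (induction rule: pl_path.induct) (auto simp: graph_points_def)

lemma pl_path_nonneg: "pl_path G x l y \<Longrightarrow> 0 \<le> l"
  by (induction rule: pl_path.induct) auto

lemma pl_path_trans:
  assumes "pl_path G y l' z" "pl_path G x l y"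
  shows "pl_path G x (l + l') z"
  using assms
proof (induction rule: pl_path.induct)
  case (step y l' u v s t)
  then have "pl_path G x (l + l' + \<bar>t - s\<bar>) (edge_point u v t)"
    by (blast intro: pl_path.step)
  then show ?case by (simp add: add.assoc)
qed simp

lemma pl_path_edge:
  assumes "(u, v) \<in> parcs G" "s \<in> {0..1}" "t \<in> {0..1}"
  shows "pl_path G (edge_point u v s) \<bar>t - s\<bar> (edge_point u v t)"
proof -
  have "edge_point u v s \<in> graph_points G"
    using assms by (auto simp: graph_points_def)
  from pl_path.step[OF pl_path.refl[OF this] assms] show ?thesis by simp
qed

lemma pl_path_sym: "pl_path G x l y \<Longrightarrow> pl_path G y l x"
proof (induction rule: pl_path.induct)
  case (step x l u v s t)
  from pl_path_trans[OF step.IH pl_path_edge[OF step.hyps(2,4,3)]]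
  show ?case by (simp add: abs_minus_commute add.commute)
qed (rule pl_path.refl)

lemma graph_dist_le: "pl_path G x l y \<Longrightarrow> graph_dist G x y \<le> l"
  by (auto simp: graph_dist_def intro!: cInf_lower bdd_belowI[of _ 0] dest: pl_path_nonneg)

context pair_bidirected_digraph
begin

lemma pl_path_coord:
  assumes "pl_path G x l y"
  shows "\<bar>y w - x w\<bar> \<le> l"
  using assms
proof (induction rule: pl_path.induct)
  case (step x l u v s t)
  have "u \<noteq> v" using pair_no_loops[OF step.hyps(2)] by simp
  then have "\<bar>edge_point u v t w - edge_point u v s w\<bar> \<le> \<bar>t - s\<bar>"
    by (auto simp: edge_point_def vertex_point_def)
  then show ?case using step.IH by linarith
qed simp

lemma pl_path_reachable:
  assumes "u \<rightarrow>\<^sup>*\<^bsub>with_proj G\<^esub> v"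
  shows "\<exists>l. pl_path G (vertex_point u) l (vertex_point v)"
  using assms
proof (induction rule: reachable_induct)
  case base
  then have "vertex_point u \<in> graph_points G" by (auto simp: graph_points_def)
  then show ?case by (blast intro: pl_path.refl)
next
  case (step x y)
  then have "(x, y) \<in> parcs G" by simp
  from pl_path_edge[OF this, of 0 1]
  have "pl_path G (vertex_point x) 1 (vertex_point y)" by simp
  with step.IH show ?case by (blast intro: pl_path_trans)
qed

lemma pl_path_vertex:
  assumes "x \<in> graph_points G"
  shows "\<exists>v\<in>pverts G. \<exists>l. pl_path G x l (vertex_point v)"
proof -
  consider v where "v \<in> pverts G" "x = vertex_point v"
    | u v t where "(u, v) \<in> parcs G" "t \<in> {0..1}" "x = edge_point u v t"
    using assms by (auto simp: graph_points_def)
  then show ?thesis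
  proof cases
    case 1
    then show ?thesis using assms by (blast intro: pl_path.refl)
  next
    case 2
    then have "pl_path G x \<bar>0 - t\<bar> (vertex_point u)"
      using pl_path_edge[of u v G t 0] by simp
    then show ?thesis using in_arcsD1[OF 2(1)] by blast
  qed
qed

theorem Metric_space_graph:
  assumes "Digraph_Component.connected (with_proj G)"
  shows "Metric_space (graph_points G) (graph_dist G)"
proof -
  have "parcs (mk_symmetric (with_proj G)) = parcs G"
    using pair_sym_arcs by (auto simp: mk_symmetric_def symmetric_def dest: symD)
  then have reach: "u \<rightarrow>\<^sup>*\<^bsub>with_proj G\<^esub> v" if "u \<in> pverts G" "v \<in> pverts G" for u v
    using assms that
    by (auto simp: Digraph_Component.connected_def strongly_connected_def reachable_def mk_symmetric_def)
  have ex: "\<exists>l. pl_path G x l y" if "x \<in> graph_points G" "y \<in> graph_points G" for x y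
    using pl_path_vertex[OF that(1)] pl_path_vertex[OF that(2)] pl_path_reachable[OF reach]
    by (meson pl_path_sym pl_path_trans)
  have dist: "graph_dist G x y = Inf {l. pl_path G x l y}"
    if "x \<in> graph_points G" "y \<in> graph_points G" for x y
    using ex[OF that] by (simp add: graph_dist_def)
  have coord: "\<bar>y w - x w\<bar> \<le> graph_dist G x y" if "x \<in> graph_points G" "y \<in> graph_points G" for x y w
    unfolding dist[OF that] using ex[OF that] by (intro cInf_greatest) (auto dest: pl_path_coord)
  show ?thesis
  proof
    show "0 \<le> graph_dist G x y" for x y
      by (auto simp: graph_dist_def intro!: cInf_greatest dest: pl_path_nonneg)
  next
    have "pl_path G x l y \<longleftrightarrow> pl_path G y l x" for x y l
      by (blast intro: pl_path_sym)
    then show "graph_dist G x y = graph_dist G y x" for x y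
      by (simp add: graph_dist_def)
  next
    fix x y assume xy: "x \<in> graph_points G" "y \<in> graph_points G"
    show "graph_dist G x y = 0 \<longleftrightarrow> x = y"
    proof
      assume "graph_dist G x y = 0"
      with coord[OF xy] show "x = y" by fastforce
    next
      assume "x = y"
      with graph_dist_le[OF pl_path.refl[OF xy(1)]] coord[OF xy]
      show "graph_dist G x y = 0" by fastforce
    qed
  next
    fix x y z assume xyz: "x \<in> graph_points G" "y \<in> graph_points G" "z \<in> graph_points G"
    have *: "graph_dist G x z \<le> l + l'" if "pl_path G x l y" "pl_path G y l' z" for l l'
      using that by (blast intro: graph_dist_le pl_path_trans)
    have "graph_dist G x z - l \<le> graph_dist G y z" if "pl_path G x l y" for l
      unfolding dist[OF xyz(2,3)] using ex[OF xyz(2,3)] *[OF that]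
      by (intro cInf_greatest) (auto simp: algebra_simps)
    then have "graph_dist G x z - graph_dist G y z \<le> graph_dist G x y"
      unfolding dist[OF xyz(1,2)] using ex[OF xyz(1,2)]
      by (intro cInf_greatest) (auto simp: algebra_simps)
    then show "graph_dist G x z \<le> graph_dist G x y + graph_dist G y z" by simp
  qed
qed

end

end

theory Submission
  imports Defs
begin

text \<open>
  Let \<open>p\<close> lie on a side \<open>A\<close> of a geodesic triangle, say at distance \<open>s\<close>
  from the corner \<open>x1\<close>, and at distance at least \<open>3/2\<close> from both ends \<open>x1\<close>, \<open>x2\<close> of \<open>A\<close>;
  closer points cause no problem, because the ends lie on the other sides.  Near \<open>x1\<close> and near
  \<open>x2\<close> the side passes through vertices \<open>a\<close> and \<open>b\<close>.  The vertices \<open>v\<close> with \<open>\<kappa> \<le> d(a, v) < \<kappa> + 1\<close> separate \<open>a\<close>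
  from \<open>b\<close>, because the distance to \<open>a\<close> changes by at most 1 along an edge
  (\<open>annulus_separates\<close>); choose \<open>\<kappa>\<close> so that \<open>d(a, p)\<close> is the middle of this range.  The
  annulus contains a minimal \<open>ab\<close>-separator \<open>S\<close> (\<open>minimal_separator_within\<close>).

  Both \<open>A\<close> and the union of the two other sides join the component of \<open>a\<close> off \<open>S\<close> to its
  complement, so both must cross \<open>S\<close> (\<open>path_crosses_boundary\<close>).  As \<open>A\<close> is a geodesic through \<open>a\<close>,
  its position is determined by the distance to \<open>a\<close>, so that \<open>A\<close> meets \<open>S\<close> within \<open>1/2\<close> of \<open>p\<close>.
  The other sides come within \<open>1/2\<close> of \<open>S\<close>; the reason why they need not meet \<open>S\<close> itself is that
  they may start or end inside an edge with both ends in \<open>S\<close>.  If the diameter of \<open>S\<close> is at most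
  \<open>r\<close>, then \<open>p\<close> is within \<open>1/2 + r + 1/2\<close> of the other sides.

  Hence triangles are \<open>(r + 1)\<close>-thin as soon as \<open>r \<ge> 1/2\<close>
  (\<open>delta_hyperbolic_if_separators_bounded\<close>), and \<open>m + 1 \<le> 3 m - 1/2\<close> for every integer \<open>m \<ge> 1\<close>.
\<close>

section \<open>Minimal separators\<close>

context pair_bidirected_digraph
begin

abbreviation reachable_off :: "'a set \<Rightarrow> 'a \<Rightarrow> 'a \<Rightarrow> bool" where
  "reachable_off S u v \<equiv> u \<rightarrow>\<^sup>*\<^bsub>with_proj G \<restriction> (pverts G - S)\<^esub> v"

text \<open>The boundary of \<open>W\<close> lies in \<open>S\<close>, in a form that suits inductions over walks.\<close>

definition arcs_stay_in :: "'a set \<Rightarrow> 'a set \<Rightarrow> bool" where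
  "arcs_stay_in W S \<longleftrightarrow> (\<forall>(u, v) \<in> parcs G. u \<in> W \<longrightarrow> v \<in> W \<union> S)"

lemma wf_off: "wf_digraph (with_proj G \<restriction> (pverts G - S))"
  by (rule wellformed_induce_subgraph)

lemma reachable_off_sym: "reachable_off S u v \<Longrightarrow> reachable_off S v u"
proof (rule symmetric_reachable)
  show "symmetric (with_proj G \<restriction> (pverts G - S))"
    using arcs_symmetric by (auto simp: symmetric_def arcs_ends_conv intro!: symI)
qed

lemma reachable_off_trans:
  "reachable_off S u v \<Longrightarrow> reachable_off S v w \<Longrightarrow> reachable_off S u w"
  by (rule wf_digraph.reachable_trans[OF wf_off])

lemma reachable_off_arc:
  assumes "(u, v) \<in> parcs G" "u \<notin> S" "v \<notin> S"
  shows "reachable_off S u v"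
  using assms in_arcsD1[OF assms(1)] in_arcsD2[OF assms(1)]
  by (intro wf_digraph.reachable_adjI[OF wf_off]) (auto simp: arcs_ends_conv)

lemma reachable_off_antimono: "reachable_off S u v \<Longrightarrow> T \<subseteq> S \<Longrightarrow> reachable_off T u v"
  by (erule reachable_induce_ss) auto

lemma reachable_off_verts: "reachable_off S u v \<Longrightarrow> u \<in> pverts G - S \<and> v \<in> pverts G - S"
  using wf_digraph.reachable_in_verts[OF wf_off] by fastforce

lemma reachable_off_stays:
  assumes "reachable_off S u v" "arcs_stay_in W S" "u \<in> W"
  shows "v \<in> W"
  using assms(1,3)
proof (induction rule: wf_digraph.reachable_induct[OF wf_off, consumes 1, case_names base step])
  case (step x y)
  then show ?case using assms(2) by (auto simp: arcs_stay_in_def arcs_ends_conv)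
qed

lemma component_arcs_stay_in: "arcs_stay_in {v. reachable_off S a v} S"
  unfolding arcs_stay_in_def
  by (auto dest: reachable_off_verts intro: reachable_off_trans reachable_off_arc)

text \<open>By symmetry of \<open>G\<close>, strong components are reachability classes, so two vertices lie in
  different ones exactly if the second cannot be reached from the first.\<close>

lemma separator_iff:
  "separator G a b S \<longleftrightarrow>
     S \<subseteq> pverts G \<and> a \<in> pverts G - S \<and> b \<in> pverts G - S \<and> \<not> reachable_off S a b"
  (is "?L \<longleftrightarrow> ?R")
proof
  assume ?L
  then obtain A B where S: "S \<subseteq> pverts G" and ab: "a \<in> A" "b \<in> B" "A \<noteq> B"
    and A: "A \<in> pre_digraph.sccs_verts (with_proj G \<restriction> (pverts G - S))"
    and B: "B \<in> pre_digraph.sccs_verts (with_proj G \<restriction> (pverts G - S))"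
    by (auto simp: separator_def)
  have "A \<inter> B = {}" using wf_digraph.sccs_verts_disjoint[OF wf_off A B ab(3)] .
  then have "\<not> reachable_off S a b"
    using A ab(1,2) reachable_off_sym[of S a b] unfolding pre_digraph.sccs_verts_def by blast
  moreover have "reachable_off S a a" "reachable_off S b b"
    using A B ab(1,2) unfolding pre_digraph.sccs_verts_def by blast+
  ultimately show ?R using S by (auto dest: reachable_off_verts)
next
  assume R: ?R
  let ?C = "\<lambda>a. {v. reachable_off S a v}"
  have "?C x \<in> pre_digraph.sccs_verts (with_proj G \<restriction> (pverts G - S)) \<and> x \<in> ?C x"
    if "x \<in> pverts G - S" for x
  proof -
    have "reachable_off S x x" using that by (intro wf_digraph.reachable_refl[OF wf_off]) auto
    then show ?thesis
      unfolding pre_digraph.sccs_verts_def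
      by (auto intro: reachable_off_sym reachable_off_trans)
  qed
  with R show ?L unfolding separator_def by blast
qed

text \<open>Take boundaries twice: \<open>N\<close> is the part of \<open>S\<^sub>0\<close> adjacent to the component \<open>B\<close> of \<open>b\<close> off
  \<open>S\<^sub>0\<close>, and \<open>S\<close> is the part of \<open>N\<close> adjacent to the component \<open>A\<close> of \<open>a\<close> off \<open>N\<close>.  Every vertex
  of \<open>S\<close> then has neighbours in both \<open>A\<close> and \<open>B\<close>, so that restoring any one of them joins \<open>a\<close> to
  \<open>b\<close>.\<close>

lemma minimal_separator_within:
  assumes "separator G a b S\<^sub>0"
  obtains S where "S \<subseteq> S\<^sub>0" "minimal_separator G a b S"
proof -
  note sep = assms[unfolded separator_iff]
  define B where "B = {v. reachable_off S\<^sub>0 b v}"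
  define N where "N = {v \<in> S\<^sub>0. \<exists>w\<in>B. (w, v) \<in> parcs G}"
  define A where "A = {v. reachable_off N a v}"
  define S where "S = {v \<in> N. \<exists>w\<in>A. (w, v) \<in> parcs G}"
  have NS: "N \<subseteq> S\<^sub>0" "S \<subseteq> N" by (auto simp: N_def S_def)
  have B: "arcs_stay_in B N"
    using component_arcs_stay_in[of S\<^sub>0 b] unfolding arcs_stay_in_def B_def N_def by blast
  have A: "arcs_stay_in A S"
    using component_arcs_stay_in[of N a] unfolding arcs_stay_in_def A_def S_def by blast
  have refl: "reachable_off T x x" if "x \<in> pverts G - T" for x T
    using that by (intro wf_digraph.reachable_refl[OF wf_off]) auto
  have bB: "b \<in> B" and aA: "a \<in> A" using refl sep NS by (auto simp: B_def A_def)
  have "a \<notin> B" using sep by (auto simp: B_def dest: reachable_off_sym)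
  then have "\<not> reachable_off N b a" using reachable_off_stays[OF _ B bB] by blast
  then have "b \<notin> A" by (auto simp: A_def dest: reachable_off_sym)
  then have "\<not> reachable_off S a b" using reachable_off_stays[OF _ A aA] by blast
  then have "separator G a b S" using sep NS by (auto simp: separator_iff)
  moreover have "\<not> separator G a b T" if T: "T \<subset> S" for T
  proof -
    obtain v where v: "v \<in> S" "v \<notin> T" using T by blast
    then obtain w w' where w: "w \<in> A" "(w, v) \<in> parcs G" and w': "w' \<in> B" "(w', v) \<in> parcs G"
      by (auto simp: S_def N_def)
    have aw: "reachable_off T a w" and bw': "reachable_off T b w'"
      using w(1) w'(1) NS T reachable_off_antimono[of N a w T] reachable_off_antimono[of S\<^sub>0 b w' T]
      by (auto simp: A_def B_def)
    have "reachable_off T w v" "reachable_off T w' v"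
      using reachable_off_arc w(2) w'(2) v(2) reachable_off_verts[OF aw] reachable_off_verts[OF bw']
      by blast+
    then have "reachable_off T a b"
      using aw bw' by (meson reachable_off_sym reachable_off_trans)
    then show ?thesis by (simp add: separator_iff)
  qed
  ultimately have "minimal_separator G a b S" by (auto simp: minimal_separator_def)
  with NS that show thesis by blast
qed

end

section \<open>The geometric realization\<close>

locale connected_graph = pair_bidirected_digraph +
  assumes connected: "Digraph_Component.connected (with_proj G)"

sublocale connected_graph \<subseteq> Metric_space "graph_points G" "graph_dist G"
  by (rule Metric_space_graph[OF connected])

context connected_graph
begin

text \<open>The vertices of the smallest cell (vertex or edge) that contains the point \<open>x\<close>.\<close>

definition support :: "('a \<Rightarrow> real) \<Rightarrow> 'a set" where
  "support x = {w. 0 < x w}"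

lemma vertex_point_in: "v \<in> pverts G \<Longrightarrow> vertex_point v \<in> graph_points G"
  by (auto simp: graph_points_def)

lemma support_vertex_point [simp]: "support (vertex_point v) = {v}"
  by (auto simp: support_def vertex_point_def)

lemma support_edge_point:
  "(u, v) \<in> parcs G \<Longrightarrow> 0 < t \<Longrightarrow> t < 1 \<Longrightarrow> support (edge_point u v t) = {u, v}"
  using pair_no_loops[of "(u, v)"] by (auto simp: support_def edge_point_def vertex_point_def)

lemma graph_point_cases:
  assumes "x \<in> graph_points G"
  obtains (vertex) v where "v \<in> pverts G" "x = vertex_point v" "support x = {v}"
  | (edge) u v t where "(u, v) \<in> parcs G" "0 < t" "t < 1" "x = edge_point u v t" "u \<noteq> v"
      "support x = {u, v}"
proof -
  consider v where "v \<in> pverts G" "x = vertex_point v"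
    | u v t where "(u, v) \<in> parcs G" "0 < t" "t < 1" "x = edge_point u v t"
    using assms in_arcsD1 in_arcsD2
    by (auto simp: graph_points_def) (metis edge_point_0 edge_point_1 order_le_less)
  then show thesis
  proof cases
    case 1
    then show thesis using vertex by simp
  next
    case (2 u v t)
    then show thesis using edge pair_no_loops[OF 2(1)] support_edge_point[OF 2(1-3)] by simp
  qed
qed

lemma support_adjacent:
  assumes "x \<in> graph_points G" "u \<in> support x" "v \<in> support x"
  shows "u = v \<or> (u, v) \<in> parcs G"
  using assms(1)
  by (cases rule: graph_point_cases) (use assms(2,3) arcs_symmetric in auto)

text \<open>This bound gives both the continuity of the coordinates along a path and the fact that a vertex
  at distance less than 1 from a point is in the support of that point.\<close>

lemma coordinate_le_dist:
  assumes "x \<in> graph_points G" "y \<in> graph_points G"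
  shows "\<bar>y w - x w\<bar> \<le> graph_dist G x y"
proof -
  \<comment> \<open>Points not joined by a path would have the default distance 0 and so coincide.\<close>
  have ex: "\<exists>l. pl_path G x l y"
  proof (rule ccontr)
    assume "\<not> ?thesis"
    moreover from this have "x = y" using zero[OF assms] by (simp add: graph_dist_def)
    ultimately show False using pl_path.refl[OF assms(1)] by blast
  qed
  then have "graph_dist G x y = Inf {l. pl_path G x l y}" by (simp add: graph_dist_def)
  also have "\<bar>y w - x w\<bar> \<le> \<dots>"
    using ex by (intro cInf_greatest) (auto dest: pl_path_coord)
  finally show ?thesis .
qed

lemma dist_vertex_lt_1_support:
  assumes "x \<in> graph_points G" "v \<in> pverts G" "graph_dist G x (vertex_point v) < 1"
  shows "v \<in> support x"
  using coordinate_le_dist[OF assms(1) vertex_point_in[OF assms(2)], of v] assms(3)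
  by (simp add: support_def vertex_point_def)

lemma edge_dist_le:
  assumes "(u, v) \<in> parcs G" "s \<in> {0..1}" "t \<in> {0..1}"
  shows "graph_dist G (edge_point u v s) (edge_point u v t) \<le> \<bar>t - s\<bar>"
  using graph_dist_le[OF pl_path_edge[OF assms]] .

lemma adjacent_dist_le_1:
  "(u, v) \<in> parcs G \<Longrightarrow> graph_dist G (vertex_point u) (vertex_point v) \<le> 1"
  using edge_dist_le[of u v 0 1] by simp

lemma support_vertex_near:
  assumes "x \<in> graph_points G"
  obtains v where "v \<in> support x" "graph_dist G x (vertex_point v) \<le> 1/2"
  using assms
proof (cases rule: graph_point_cases)
  case (vertex v)
  then show thesis using that[of v] zero[OF assms assms] by simp
next
  case (edge u v t)
  show thesis
  proof (cases "t \<le> 1/2")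
    case True
    then show thesis using that[of u] edge edge_dist_le[OF edge(1), of t 0] by simp
  next
    case False
    then show thesis using that[of v] edge edge_dist_le[OF edge(1), of t 1] by simp
  qed
qed

section \<open>Paths crossing a separator\<close>

definition lipschitz_path :: "(real \<Rightarrow> 'a \<Rightarrow> real) \<Rightarrow> real \<Rightarrow> real \<Rightarrow> bool" where
  "lipschitz_path \<gamma> l r \<longleftrightarrow> \<gamma> ` {l..r} \<subseteq> graph_points G \<and>
     (\<forall>s\<in>{l..r}. \<forall>t\<in>{l..r}. graph_dist G (\<gamma> s) (\<gamma> t) \<le> \<bar>s - t\<bar>)"

text \<open>Since coordinates are continuous along the path, a positive coordinate stays positive
  nearby: the support of \<open>\<gamma> u\<close> contains that of \<open>\<gamma> t\<close> for all \<open>u\<close> near \<open>t\<close>.  So a property that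
  does not change when the support grows is locally constant along the path, hence constant.\<close>

lemma support_invariant_along_path:
  assumes path: "lipschitz_path \<gamma> l r"
    and inv: "\<And>s t. s \<in> {l..r} \<Longrightarrow> t \<in> {l..r} \<Longrightarrow> support (\<gamma> s) \<subseteq> support (\<gamma> t) \<Longrightarrow>
                P (\<gamma> s) \<longleftrightarrow> P (\<gamma> t)"
    and st: "s \<in> {l..r}" "t \<in> {l..r}"
  shows "P (\<gamma> s) \<longleftrightarrow> P (\<gamma> t)"
proof -
  have pts: "\<gamma> t \<in> graph_points G" if "t \<in> {l..r}" for t
    using path that by (auto simp: lipschitz_path_def)
  have loc: "\<exists>e>0. \<forall>u\<in>{l..r}. dist u t < e \<longrightarrow> support (\<gamma> t) \<subseteq> support (\<gamma> u)"
    if t: "t \<in> {l..r}" for t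
  proof -
    have fin: "finite (support (\<gamma> t))"
      using pts[OF t] by (cases rule: graph_point_cases) auto
    have "0 < Min (insert 1 (\<gamma> t ` support (\<gamma> t)))"
      using fin by (subst Min_gr_iff) (auto simp: support_def)
    moreover have "support (\<gamma> t) \<subseteq> support (\<gamma> u)"
      if u: "u \<in> {l..r}" "dist u t < Min (insert 1 (\<gamma> t ` support (\<gamma> t)))" for u
    proof
      fix w assume w: "w \<in> support (\<gamma> t)"
      have "graph_dist G (\<gamma> t) (\<gamma> u) \<le> \<bar>t - u\<bar>"
        using path t u(1) unfolding lipschitz_path_def by blast
      then have "\<bar>\<gamma> u w - \<gamma> t w\<bar> \<le> \<bar>t - u\<bar>"
        using coordinate_le_dist[OF pts[OF t] pts[OF u(1)], of w] by linarith
      also have "\<dots> < \<gamma> t w"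
        using u(2) w fin by (auto simp: dist_real_def Min_gr_iff)
      finally show "w \<in> support (\<gamma> u)" by (auto simp: support_def)
    qed
    ultimately show ?thesis by blast
  qed
  show ?thesis
  proof (rule connected_induction_simple[where P = "\<lambda>u. P (\<gamma> s) = P (\<gamma> u)" and S = "{l..r}" and a = s])
    fix u assume u: "u \<in> {l..r}"
    then obtain e where "e > 0" and e: "\<forall>v\<in>{l..r}. dist v u < e \<longrightarrow> support (\<gamma> u) \<subseteq> support (\<gamma> v)"
      using loc by blast
    let ?T = "{l..r} \<inter> ball u e"
    have "P (\<gamma> v) = P (\<gamma> u)" if "v \<in> ?T" for v
      using that e inv[OF u, of v] by (auto simp: dist_commute)
    then have "\<forall>x\<in>?T. \<forall>y\<in>?T. (P (\<gamma> s) = P (\<gamma> x)) \<longrightarrow> (P (\<gamma> s) = P (\<gamma> y))"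
      by metis
    moreover have "openin (top_of_set {l..r}) ?T" "u \<in> ?T"
      using u \<open>e > 0\<close> by (auto simp: openin_open_Int)
    ultimately show "\<exists>T. openin (top_of_set {l..r}) T \<and> u \<in> T \<and>
        (\<forall>x\<in>T. \<forall>y\<in>T. (P (\<gamma> s) = P (\<gamma> x)) \<longrightarrow> (P (\<gamma> s) = P (\<gamma> y)))"
      by blast
  qed (use st in auto)
qed

text \<open>A path from the star of \<open>W\<close> to a point outside it contains a point of the subgraph induced
  on \<open>S\<close>.  Otherwise each support on the path has a vertex \<open>w\<close> off \<open>S\<close>, and then the support meets
  \<open>W\<close> if and only if \<open>w\<close> is in \<open>W\<close>, because vertices of one cell are adjacent.  Hence meeting \<open>W\<close> does not
  change along the path.\<close>

lemma path_crosses_boundary: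
  assumes path: "lipschitz_path \<gamma> l r"
    and W: "arcs_stay_in W S" "W \<inter> S = {}"
    and st: "s \<in> {l..r}" "t \<in> {l..r}"
    and ends: "support (\<gamma> s) \<inter> W \<noteq> {}" "support (\<gamma> t) \<inter> W = {}"
  obtains u where "u \<in> {l..r}" "support (\<gamma> u) \<subseteq> S"
proof (rule ccontr)
  assume "\<not> thesis"
  with that have S: "\<not> support (\<gamma> u) \<subseteq> S" if "u \<in> {l..r}" for u using \<open>u \<in> {l..r}\<close> by blast
  have "(support (\<gamma> s) \<inter> W \<noteq> {}) = (support (\<gamma> t) \<inter> W \<noteq> {})"
  proof (rule support_invariant_along_path[OF path _ st, where P = "\<lambda>x. support x \<inter> W \<noteq> {}"])
    fix s t assume s: "s \<in> {l..r}" and t: "t \<in> {l..r}" and sub: "support (\<gamma> s) \<subseteq> support (\<gamma> t)"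
    have pt: "\<gamma> t \<in> graph_points G" using path t by (auto simp: lipschitz_path_def)
    obtain w where w: "w \<in> support (\<gamma> s)" "w \<notin> S" using S[OF s] by blast
    have "w \<in> W" if "w' \<in> support (\<gamma> t) \<inter> W" for w'
    proof -
      have "w' = w \<or> (w', w) \<in> parcs G"
        using support_adjacent[OF pt, of w' w] that w sub by blast
      then show ?thesis using that w W(1) by (auto simp: arcs_stay_in_def)
    qed
    then show "(support (\<gamma> s) \<inter> W \<noteq> {}) = (support (\<gamma> t) \<inter> W \<noteq> {})"
      using w sub by blast
  qed
  with ends show False by simp
qed

definition geodesic_path :: "(real \<Rightarrow> 'a \<Rightarrow> real) \<Rightarrow> real \<Rightarrow> bool" where
  "geodesic_path \<gamma> L \<longleftrightarrow> 0 \<le> L \<and> \<gamma> ` {0..L} \<subseteq> graph_points G \<and>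
     (\<forall>s\<in>{0..L}. \<forall>t\<in>{0..L}. graph_dist G (\<gamma> s) (\<gamma> t) = \<bar>s - t\<bar>)"

lemma geodesic_segment_iff:
  "geodesic_segment x y A \<longleftrightarrow>
     (\<exists>\<gamma> L. geodesic_path \<gamma> L \<and> \<gamma> 0 = x \<and> \<gamma> L = y \<and> A = \<gamma> ` {0..L})"
  by (auto simp: geodesic_segment_def geodesic_path_def)

lemma geodesic_lipschitz:
  "geodesic_path \<gamma> L \<Longrightarrow> 0 \<le> l \<Longrightarrow> r \<le> L \<Longrightarrow> lipschitz_path \<gamma> l r"
  unfolding geodesic_path_def lipschitz_path_def by force

lemma geodesic_reverse: "geodesic_path \<gamma> L \<Longrightarrow> geodesic_path (\<lambda>t. \<gamma> (L - t)) L"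
  unfolding geodesic_path_def by fastforce

text \<open>While a path meets no vertex, it remains inside one edge, so its points stay at distance less
  than \<open>r = max \<tau> (1 - \<tau>) < 1\<close> from the starting point with coordinate \<open>\<tau>\<close>.  A geodesic is at
  distance \<open>r\<close> from it at time \<open>r\<close>.  That the vertex is reached strictly before time 1
  makes its coordinate positive at the starting point.\<close>

lemma geodesic_hits_vertex_after:
  assumes geo: "geodesic_path \<gamma> L" and t: "0 \<le> t" "t + 1 \<le> L"
  obtains t' v where "t \<le> t'" "t' < t + 1" "v \<in> pverts G" "\<gamma> t' = vertex_point v"
proof -
  have pts: "\<gamma> u \<in> graph_points G" if "u \<in> {0..L}" for u
    using geo that by (auto simp: geodesic_path_def)
  have "\<gamma> t \<in> graph_points G" using pts t by auto
  then show thesis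
  proof (cases rule: graph_point_cases)
    case (vertex v)
    then show thesis using that[of t v] by simp
  next
    case (edge u v \<tau>)
    define r where "r = max \<tau> (1 - \<tau>)"
    have r: "0 < r" "r < 1" using edge by (auto simp: r_def)
    show thesis
    proof (rule ccontr)
      assume "\<not> thesis"
      with that r have nv: "\<gamma> t' \<noteq> vertex_point w" if "t' \<in> {t..t + r}" "w \<in> pverts G" for t' w
        using \<open>t' \<in> _\<close> \<open>w \<in> _\<close> by fastforce
      have two: "\<exists>a b. a \<noteq> b \<and> support (\<gamma> t') = {a, b}" if "t' \<in> {t..t + r}" for t'
      proof -
        have "\<gamma> t' \<in> graph_points G" using pts t that r by auto
        then show ?thesis by (cases rule: graph_point_cases) (use nv[OF that] in auto)
      qed
      have "(support (\<gamma> t) = {u, v}) = (support (\<gamma> (t + r)) = {u, v})"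
      proof (rule support_invariant_along_path[OF geodesic_lipschitz[OF geo, of t "t + r"],
              where P = "\<lambda>x. support x = {u, v}"])
        fix s s' assume "s \<in> {t..t + r}" "s' \<in> {t..t + r}" and sub: "support (\<gamma> s) \<subseteq> support (\<gamma> s')"
        then obtain a b c d where "a \<noteq> b" "support (\<gamma> s) = {a, b}" "c \<noteq> d" "support (\<gamma> s') = {c, d}"
          using two by meson
        with sub have "support (\<gamma> s) = support (\<gamma> s')" by auto
        then show "(support (\<gamma> s) = {u, v}) = (support (\<gamma> s') = {u, v})" by simp
      qed (use t r in auto)
      then have supp: "support (\<gamma> (t + r)) = {u, v}" using edge by simp
      have "\<gamma> (t + r) \<in> graph_points G" using pts t r by auto
      then obtain \<tau>' where \<tau>': "0 < \<tau>'" "\<tau>' < 1" "\<gamma> (t + r) = edge_point u v \<tau>'"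
      proof (cases rule: graph_point_cases)
        case (vertex w)
        then show thesis using supp edge(5) by auto
      next
        case (edge a b x)
        then have "a = u \<and> b = v \<or> a = v \<and> b = u" using supp by (auto simp: doubleton_eq_iff)
        then show thesis
          using edge that[of x] that[of "1 - x"] edge_point_flip[of v u x] by auto
      qed
      have "r = graph_dist G (\<gamma> t) (\<gamma> (t + r))"
        using geo t r by (auto simp: geodesic_path_def)
      also have "\<dots> \<le> \<bar>\<tau>' - \<tau>\<bar>"
        using edge_dist_le[OF edge(1), of \<tau> \<tau>'] edge \<tau>' by simp
      also have "\<dots> < r" using \<tau>' edge(2,3) by (auto simp: r_def abs_if)
      finally show False by simp
    qed
  qed
qed

lemma geodesic_hits_vertex_before:
  assumes geo: "geodesic_path \<gamma> L" and t: "1 \<le> t" "t \<le> L"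
  obtains t' v where "t - 1 < t'" "t' \<le> t" "v \<in> pverts G" "\<gamma> t' = vertex_point v"
proof -
  obtain t' v where "L - t \<le> t'" "t' < L - t + 1" "v \<in> pverts G" "\<gamma> (L - t') = vertex_point v"
    using geodesic_hits_vertex_after[OF geodesic_reverse[OF geo], of "L - t"] t by auto
  then show thesis using that[of "L - t'" v] by auto
qed

section \<open>Annuli\<close>

lemma annulus_separates:
  assumes a: "a \<in> pverts G" and b: "b \<in> pverts G"
    and "0 < \<kappa>" and "\<kappa> + 1 \<le> graph_dist G (vertex_point a) (vertex_point b)"
  shows "separator G a b
    {v \<in> pverts G. \<kappa> \<le> graph_dist G (vertex_point a) (vertex_point v) \<and>
       graph_dist G (vertex_point a) (vertex_point v) < \<kappa> + 1}" (is "separator G a b ?S")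
proof -
  let ?W = "{v. graph_dist G (vertex_point a) (vertex_point v) < \<kappa>}"
  have aa: "graph_dist G (vertex_point a) (vertex_point a) = 0"
    using zero vertex_point_in[OF a] by blast
  have "v \<in> ?W \<union> ?S" if uv: "(u, v) \<in> parcs G" and u: "u \<in> ?W" for u v
  proof -
    have "u \<in> pverts G" "v \<in> pverts G" using uv in_arcsD1 in_arcsD2 by auto
    then show ?thesis
      using triangle[OF vertex_point_in[OF a] vertex_point_in vertex_point_in, of u v]
        adjacent_dist_le_1[OF uv] u by auto
  qed
  then have "arcs_stay_in ?W ?S" by (auto simp: arcs_stay_in_def)
  then have "\<not> reachable_off ?S a b"
    using reachable_off_stays[of ?S a b ?W] assms(3,4) aa by auto
  then show ?thesis using assms aa by (auto simp: separator_iff)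
qed

section \<open>Thin triangles\<close>

lemma side_near_other_sides:
  assumes sep: "\<And>S u v. minimal_vertex_separator G S \<Longrightarrow> u \<in> S \<Longrightarrow> v \<in> S \<Longrightarrow>
                  graph_dist G (vertex_point u) (vertex_point v) \<le> r"
    and r: "1/2 \<le> r"
    and tri: "geodesic_triangle A B C"
  shows "A \<subseteq> nbhd (r + 1) (B \<union> C)"
proof
  obtain x1 x2 x3 where "geodesic_segment x1 x2 A" "geodesic_segment x2 x3 B" "geodesic_segment x3 x1 C"
    using tri by (auto simp: geodesic_triangle_def)
  then obtain \<gamma> \<beta> \<eta> L LB LC where
    A: "geodesic_path \<gamma> L" "\<gamma> 0 = x1" "\<gamma> L = x2" "A = \<gamma> ` {0..L}" and
    B: "geodesic_path \<beta> LB" "\<beta> 0 = x2" "\<beta> LB = x3" "B = \<beta> ` {0..LB}" and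
    C: "geodesic_path \<eta> LC" "\<eta> 0 = x3" "\<eta> LC = x1" "C = \<eta> ` {0..LC}"
    unfolding geodesic_segment_iff by blast
  have sub: "A \<subseteq> graph_points G" "B \<subseteq> graph_points G" "C \<subseteq> graph_points G"
    and nonneg: "0 \<le> L" "0 \<le> LB" "0 \<le> LC"
    using A B C by (auto simp: geodesic_path_def)
  have mem: "x1 \<in> C" "x2 \<in> B" using B C nonneg by force+
  fix p assume "p \<in> A"
  then obtain s where s: "s \<in> {0..L}" "p = \<gamma> s" using A by blast
  have dA: "graph_dist G (\<gamma> u) (\<gamma> v) = \<bar>u - v\<bar>" if "u \<in> {0..L}" "v \<in> {0..L}" for u v
    using A that by (auto simp: geodesic_path_def)
  have near: "p \<in> nbhd (r + 1) (B \<union> C)" if "z \<in> B \<union> C" "graph_dist G p z \<le> r + 1" for z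
  proof -
    have "p \<in> mcball z (r + 1)"
      using that sub \<open>p \<in> A\<close> by (auto simp: commute)
    then show ?thesis using that(1) by (auto simp: nbhd_def)
  qed
  show "p \<in> nbhd (r + 1) (B \<union> C)"
  proof (cases "s < 3/2 \<or> L - s < 3/2")
    case True
    then show ?thesis
    proof
      assume "s < 3/2"
      then show ?thesis using near[of x1] mem dA[OF s(1), of 0] s r A by auto
    next
      assume "L - s < 3/2"
      then show ?thesis using near[of x2] mem dA[OF s(1), of L] s r A by auto
    qed
  next
    case False
    then have sL: "3/2 \<le> s" "s + 3/2 \<le> L" by auto
    obtain \<alpha> a where a: "0 \<le> \<alpha>" "\<alpha> < 1" "a \<in> pverts G" "\<gamma> \<alpha> = vertex_point a"
      using geodesic_hits_vertex_after[OF A(1), of 0] sL by auto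
    obtain \<omega> b where b: "L - 1 < \<omega>" "\<omega> \<le> L" "b \<in> pverts G" "\<gamma> \<omega> = vertex_point b"
      using geodesic_hits_vertex_before[OF A(1), of L] sL by auto
    \<comment> \<open>Since \<open>d(a, p) = s - \<alpha>\<close>, the point \<open>p\<close> is in the middle of the annulus.\<close>
    define \<kappa> where "\<kappa> = s - \<alpha> - 1/2"
    let ?S0 = "{v \<in> pverts G. \<kappa> \<le> graph_dist G (vertex_point a) (vertex_point v) \<and>
       graph_dist G (vertex_point a) (vertex_point v) < \<kappa> + 1}"
    have "graph_dist G (vertex_point a) (vertex_point b) = \<omega> - \<alpha>"
      using dA[of \<alpha> \<omega>] a b sL by auto
    then have "separator G a b ?S0"
      using annulus_separates[of a b \<kappa>] a b sL by (simp add: \<kappa>_def)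
    then obtain S where S: "S \<subseteq> ?S0" "minimal_separator G a b S"
      by (rule minimal_separator_within)
    then have "minimal_vertex_separator G S" using a b by (auto simp: minimal_vertex_separator_def)
    note diam = sep[OF this]
    have ab: "a \<in> pverts G - S" "b \<in> pverts G - S" "\<not> reachable_off S a b"
      using S(2) by (auto simp: minimal_separator_def separator_iff)
    define W where "W = {v. reachable_off S a v}"
    have stay: "arcs_stay_in W S" unfolding W_def by (rule component_arcs_stay_in)
    have WS: "W \<inter> S = {}" by (auto simp: W_def dest: reachable_off_verts)
    have aW: "a \<in> W" and bW: "b \<notin> W \<union> S"
      using ab wf_digraph.reachable_refl[OF wf_off] by (auto simp: W_def)

    \<comment> \<open>The part of \<open>A\<close> from \<open>a\<close> to \<open>b\<close> contains a point \<open>\<gamma> t\<close> in a cell spanned by \<open>S\<close>.  The last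
      vertex \<open>\<sigma> = \<gamma> t'\<close> at or before it belongs to this cell, so \<open>A\<close> meets \<open>S\<close> itself at \<open>\<sigma>\<close>.\<close>
    obtain \<sigma> where \<sigma>: "\<sigma> \<in> S" "graph_dist G p (vertex_point \<sigma>) \<le> 1/2"
    proof -
      obtain t where t: "t \<in> {\<alpha>..\<omega>}" "support (\<gamma> t) \<subseteq> S"
        by (rule path_crosses_boundary[OF geodesic_lipschitz[OF A(1), of \<alpha> \<omega>] stay WS, of \<alpha> \<omega>])
          (use a b sL aW bW in auto)
      have pt: "\<gamma> t \<in> graph_points G" using t a b A sub by auto
      \<comment> \<open>Otherwise \<open>a\<close> would be a vertex of that cell.  It follows that \<open>\<sigma>\<close> comes after \<open>a\<close> on
        \<open>A\<close>, so its distance to \<open>a\<close> determines its position.\<close>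
      have "\<alpha> + 1 \<le> t"
      proof (rule ccontr)
        assume "\<not> ?thesis"
        then have "a \<in> support (\<gamma> t)"
          using dist_vertex_lt_1_support[OF pt a(3)] dA[of t \<alpha>] t a b by simp
        then show False using t ab by blast
      qed
      then obtain t' \<sigma> where t': "t - 1 < t'" "t' \<le> t" "\<sigma> \<in> pverts G" "\<gamma> t' = vertex_point \<sigma>"
        using geodesic_hits_vertex_before[OF A(1), of t] t a b by auto
      have "\<sigma> \<in> support (\<gamma> t)"
        using dist_vertex_lt_1_support[OF pt t'(3)] dA[of t t'] t t' a b \<open>\<alpha> + 1 \<le> t\<close> by simp
      then have "\<sigma> \<in> S" using t by blast
      moreover have "graph_dist G (vertex_point a) (vertex_point \<sigma>) = t' - \<alpha>"
        using dA[of \<alpha> t'] t t' a b \<open>\<alpha> + 1 \<le> t\<close> by simp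
      moreover have "graph_dist G p (vertex_point \<sigma>) = \<bar>s - t'\<bar>"
        using dA[of s t'] t t' a b \<open>\<alpha> + 1 \<le> t\<close> s by simp
      ultimately show thesis using that[of \<sigma>] S(1) by (auto simp: \<kappa>_def abs_if)
    qed

    \<comment> \<open>The two other sides lead from \<open>x1\<close>, in the star of the component of \<open>a\<close>, through \<open>x3\<close> to
      \<open>x2\<close>, outside this star; one of them crosses \<open>S\<close>, depending on where \<open>x3\<close> lies.\<close>
    have "a \<in> support x1" "b \<in> support x2"
      using dist_vertex_lt_1_support[of x1 a] dist_vertex_lt_1_support[of x2 b] mem sub
        dA[of 0 \<alpha>] dA[of L \<omega>] a b sL A by auto
    moreover have "x2 \<in> graph_points G" using mem sub by auto
    ultimately have x1: "support x1 \<inter> W \<noteq> {}" and x2: "support x2 \<inter> W = {}"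
      using aW bW support_adjacent[of x2 _ b] stay by (auto simp: arcs_stay_in_def)
    obtain z where z: "z \<in> B \<union> C" "support z \<subseteq> S"
    proof (cases "support x3 \<inter> W = {}")
      case True
      obtain u where "u \<in> {0..LC}" "support (\<eta> u) \<subseteq> S"
        by (rule path_crosses_boundary[OF geodesic_lipschitz[OF C(1), of 0 LC] stay WS, of LC 0])
          (use True x1 C nonneg in auto)
      then show thesis using that[of "\<eta> u"] C by auto
    next
      case False
      obtain u where "u \<in> {0..LB}" "support (\<beta> u) \<subseteq> S"
        by (rule path_crosses_boundary[OF geodesic_lipschitz[OF B(1), of 0 LB] stay WS, of LB 0])
          (use False x2 B nonneg in auto)
      then show thesis using that[of "\<beta> u"] B by auto
    qed
    then have zG: "z \<in> graph_points G" using sub by auto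
    then obtain \<tau> where \<tau>: "\<tau> \<in> support z" "graph_dist G z (vertex_point \<tau>) \<le> 1/2"
      by (rule support_vertex_near)
    then have "\<tau> \<in> S" using z by blast
    have V: "vertex_point \<sigma> \<in> graph_points G" "vertex_point \<tau> \<in> graph_points G"
      using \<sigma>(1) \<open>\<tau> \<in> S\<close> S(1) vertex_point_in by auto
    have pG: "p \<in> graph_points G" using \<open>p \<in> A\<close> sub by auto
    have "graph_dist G p z \<le> graph_dist G p (vertex_point \<sigma>)
        + graph_dist G (vertex_point \<sigma>) (vertex_point \<tau>) + graph_dist G z (vertex_point \<tau>)"
      using triangle[OF pG V(1) zG] triangle[OF V zG] by (simp add: commute)
    also have "\<dots> \<le> r + 1" using \<sigma>(2) \<tau>(2) diam[OF \<sigma>(1) \<open>\<tau> \<in> S\<close>] by simp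
    finally show ?thesis using near z by blast
  qed
qed

lemma geodesic_triangle_rotate: "geodesic_triangle A B C \<Longrightarrow> geodesic_triangle B C A"
  unfolding geodesic_triangle_def by blast

theorem delta_hyperbolic_if_separators_bounded:
  assumes "\<And>S u v. minimal_vertex_separator G S \<Longrightarrow> u \<in> S \<Longrightarrow> v \<in> S \<Longrightarrow>
              graph_dist G (vertex_point u) (vertex_point v) \<le> r"
    and "1/2 \<le> r"
  shows "delta_hyperbolic (r + 1)"
proof -
  have "A \<subseteq> nbhd (r + 1) (B \<union> C)" if "geodesic_triangle A B C" for A B C
    by (rule side_near_other_sides[OF _ assms(2) that]) (rule assms(1))
  then show ?thesis
    unfolding delta_hyperbolic_def thin_def by (metis geodesic_triangle_rotate)
qed

lemma delta_hyperbolic_mono: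
  assumes "delta_hyperbolic \<delta>" "\<delta> \<le> \<delta>'"
  shows "delta_hyperbolic \<delta>'"
proof -
  have "nbhd \<delta> A \<subseteq> nbhd \<delta>' A" for A
    using assms(2) by (force simp: nbhd_def)
  then show ?thesis using assms(1) unfolding delta_hyperbolic_def thin_def by blast
qed

end

theorem corollary2p20:
  fixes G :: "'a pair_pre_digraph" and m :: nat
  assumes "pair_bidirected_digraph G"
    and "Digraph_Component.connected (with_proj G)"
    and "uniform_graph G"
    and "m \<ge> 1"
    and "\<And>S. minimal_vertex_separator G S \<Longrightarrow>
           Metric_space.mdiameter (graph_dist G) (vertex_point ` S) \<le> of_nat m"
  shows "Metric_space.hyperbolic (graph_points G) (graph_dist G) \<and>
         Metric_space.hyperbolicity_constant (graph_points G) (graph_dist G) \<le> ereal (3 * real m - 1 / 2)"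
proof -
  interpret connected_graph G
    using assms(1,2) by (simp add: connected_graph_def connected_graph_axioms_def)
  have "graph_dist G (vertex_point u) (vertex_point v) \<le> real m"
    if "minimal_vertex_separator G S" "u \<in> S" "v \<in> S" for S u v
  proof -
    have "ennreal (graph_dist G (vertex_point u) (vertex_point v)) \<le> mdiameter (vertex_point ` S)"
      unfolding mdiameter_def
      by (rule SUP_upper2[of "(vertex_point u, vertex_point v)"]) (use that in auto)
    also have "\<dots> \<le> ennreal (real m)"
      using assms(5)[OF that(1)] by (simp add: ennreal_of_nat_eq_real_of_nat)
    finally show ?thesis by simp
  qed
  then have "delta_hyperbolic (real m + 1)"
    using assms(4) by (intro delta_hyperbolic_if_separators_bounded) auto
  then have hyp: "delta_hyperbolic (3 * real m - 1/2)"
    by (rule delta_hyperbolic_mono) (use assms(4) in simp)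
  then have "hyperbolic"
    using assms(4) by (auto simp: hyperbolic_def intro!: exI[of _ "3 * real m - 1/2"])
  moreover have "hyperbolicity_constant \<le> ereal (3 * real m - 1/2)"
    unfolding hyperbolicity_constant_def by (rule Inf_lower) (use hyp in blast)
  ultimately show ?thesis by simp
qed

end
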